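(* Let $\preceq$ be a partial order on $\mathbb{R}$ such that the set $\{(x,y)\in\mathbb{R}\times\mathbb{R}: x\preceq y\}$ is a Borel subset of $\mathbb{R}\times\mathbb{R}$, such that $x\preceq y$ implies $x\leqslant y$ for all $x,y\in\mathbb{R}$, and such that the poset $P=(\mathbb{R},\preceq)$ has finite width. Then every maximal chain in $P$ is a Borel subset of $\mathbb{R}$.
   Context: The width of a poset is the maximum size of an antichain in it. A chain is a set of pairwise comparable elements; a maximal chain is a chain not properly contained in any other chain. *)

theory Defs
  imports "HOL-Analysis.Analysis"
begin

definition antichain_on :: "'a set \<Rightarrow> ('a \<times> 'a) set \<Rightarrow> 'a set \<Rightarrow> bool" where
  "antichain_on P r A \<longleftrightarrow>
     A \<subseteq> P \<and> (\<forall>x\<in>A. \<forall>y\<in>A. x \<noteq> y \<longrightarrow> (x, y) \<notin> r \<and> (y, x) \<notin> r)"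

(* Finiteness of A is required explicitly because card is 0 on infinite sets;
   a poset with an infinite antichain has no width in this sense. *)
definition has_width :: "'a set \<Rightarrow> ('a \<times> 'a) set \<Rightarrow> nat \<Rightarrow> bool" where
  "has_width P r n \<longleftrightarrow>
     (\<exists>A. antichain_on P r A \<and> finite A \<and> card A = n) \<and>
     (\<forall>A. antichain_on P r A \<longrightarrow> finite A \<and> card A \<le> n)"

definition finite_width :: "'a set \<Rightarrow> ('a \<times> 'a) set \<Rightarrow> bool" where
  "finite_width P r \<longleftrightarrow> (\<exists>n. has_width P r n)"

(* The chains of pred_on are taken with respect to the reflexive closure of its
   relation, which leaves a reflexive r unchanged. *)
definition maximal_chain_on :: "'a set \<Rightarrow> ('a \<times> 'a) set \<Rightarrow> 'a set \<Rightarrow> bool" where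
  "maximal_chain_on P r C \<longleftrightarrow> pred_on.maxchain P (\<lambda>x y. (x, y) \<in> r) C"

end

(* On a chain C the order r agrees with the usual order of the reals. Choose a countable D in C such
   that every point of C - D is a limit of D from both sides. If x is comparable with all of D but not
   with some c in C, then c is not in D, the points of D below c lie r-below x and those above c lie
   r-above x, so x = c, which is absurd. By maximality C is therefore the set of points comparable
   with all of D, a countable intersection of Borel sets. *)
theory Submission
  imports Defs
begin

text \<open>\<open>D\<close> takes one point of \<open>C\<close> from each rational interval that
  meets \<open>C\<close>, together with the points of \<open>C\<close> that end a gap of
  \<open>C\<close> starting at a rational. A point outside \<open>D\<close> ends no such gap, so
  \<open>C\<close> accumulates at it from the left, and the chosen points do too.\<close>

lemma countable_left_dense_subset:
  fixes C :: "real set"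
  obtains D where "countable D" "D \<subseteq> C"
    and "\<And>c y. c \<in> C - D \<Longrightarrow> y < c \<Longrightarrow> \<exists>d\<in>D. y < d \<and> d < c"
proof -
  define I where "I = {(p, q). p \<in> \<rat> \<and> q \<in> \<rat> \<and> C \<inter> {p<..<q} \<noteq> {}}"
  define f where "f = (\<lambda>(p, q). SOME c. c \<in> C \<inter> {p<..<q})"
  \<comment> \<open>\<open>M p\<close> holds the least point of \<open>C\<close> above
    \<open>p\<close>, if there is one; so it has at most one element.\<close>
  define M where "M p = {c \<in> C. p < c \<and> C \<inter> {p<..<c} = {}}" for p
  define D where "D = f ` I \<union> (\<Union>p\<in>\<rat>. M p)"
  have f: "f (p, q) \<in> C \<inter> {p<..<q}" if "(p, q) \<in> I" for p q
  proof -
    have "\<exists>c. c \<in> C \<inter> {p<..<q}" using that by (auto simp: I_def)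
    then show ?thesis unfolding f_def by (simp only: prod.case) (rule someI_ex)
  qed
  have "I \<subseteq> \<rat> \<times> \<rat>" by (auto simp: I_def)
  then have "countable I"
    by (rule countable_subset) (simp add: countable_rat)
  moreover have "countable (M p)" for p
  proof -
    have "c = c'" if "c \<in> M p" "c' \<in> M p" for c c'
      using that by (auto simp: M_def disjoint_iff intro: antisym leI)
    then have "M p = {} \<or> (\<exists>c. M p = {c})" by blast
    then show ?thesis by auto
  qed
  ultimately have "countable D" by (simp add: D_def countable_rat)
  moreover have "D \<subseteq> C" using f by (fastforce simp: D_def M_def)
  moreover have "\<exists>d\<in>D. y < d \<and> d < c" if c: "c \<in> C - D" and "y < c" for c y
  proof -
    obtain p where p: "p \<in> \<rat>" "y < p" "p < c" using Rats_dense_in_real[OF \<open>y < c\<close>] by blast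
    have "c \<notin> M p" using c p by (auto simp: D_def)
    then obtain c' where c': "c' \<in> C" "p < c'" "c' < c" using c p by (auto simp: M_def)
    \<comment> \<open>The interval from \<open>p\<close> to \<open>q\<close> meets \<open>C\<close>
      in \<open>c'\<close> and lies between \<open>y\<close> and \<open>c\<close>, so its chosen
      point \<open>f (p, q)\<close> is the required \<open>d\<close>.\<close>
    obtain q where q: "q \<in> \<rat>" "c' < q" "q < c" using Rats_dense_in_real[OF \<open>c' < c\<close>] by blast
    have "(p, q) \<in> I" using p c' q by (auto simp: I_def)
    then show ?thesis using f[of p q] p q by (intro bexI[of _ "f (p, q)"]) (auto simp: D_def)
  qed
  ultimately show ?thesis by (rule that)
qed

lemma countable_two_sided_dense_subset:
  fixes C :: "real set"
  obtains D where "countable D" "D \<subseteq> C"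
    and "\<And>c y. c \<in> C - D \<Longrightarrow> y < c \<Longrightarrow> \<exists>d\<in>D. y < d \<and> d < c"
    and "\<And>c y. c \<in> C - D \<Longrightarrow> c < y \<Longrightarrow> \<exists>d\<in>D. c < d \<and> d < y"
proof -
  obtain L where L: "countable L" "L \<subseteq> C"
    "\<And>c y. c \<in> C - L \<Longrightarrow> y < c \<Longrightarrow> \<exists>d\<in>L. y < d \<and> d < c"
    by (rule countable_left_dense_subset[of C]) (erule that)
  obtain R where R: "countable R" "R \<subseteq> uminus ` C"
    "\<And>c y. c \<in> uminus ` C - R \<Longrightarrow> y < c \<Longrightarrow> \<exists>d\<in>R. y < d \<and> d < c"
    by (rule countable_left_dense_subset[of "uminus ` C"]) (erule that)
  show ?thesis
  proof (rule that[of "L \<union> uminus ` R"])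
    show "countable (L \<union> uminus ` R)" using L R by simp
    show "L \<union> uminus ` R \<subseteq> C" using L R by auto
    show "\<exists>d\<in>L \<union> uminus ` R. y < d \<and> d < c" if "c \<in> C - (L \<union> uminus ` R)" "y < c" for c y
      using L(3)[of c y] that by blast
    show "\<exists>d\<in>L \<union> uminus ` R. c < d \<and> d < y" if "c \<in> C - (L \<union> uminus ` R)" and "c < y" for c y
    proof -
      have "- c \<in> uminus ` C - R" using that by force
      then obtain d where "d \<in> R" "- y < d" "d < - c" using R(3)[of "- c" "- y"] \<open>c < y\<close> by auto
      then show ?thesis by (intro bexI[of _ "- d"]) auto
    qed
  qed
qed

text \<open>The set is the union of two sections of \<open>r\<close>, the preimages of
  \<open>r\<close> under the Borel maps sending \<open>x\<close> to \<open>(x, d)\<close> and to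
  \<open>(d, x)\<close>.\<close>

lemma borel_comparable:
  fixes r :: "(real \<times> real) set"
  assumes "r \<in> sets borel"
  shows "{x. (x, d) \<in> r \<or> (d, x) \<in> r} \<in> sets borel"
proof -
  have "(\<lambda>x. (x, d)) -` r \<inter> space borel \<in> sets borel" "Pair d -` r \<inter> space borel \<in> sets borel"
    by (rule measurable_sets[OF _ assms], simp add: borel_prod[symmetric])+
  then have "(\<lambda>x. (x, d)) -` r \<union> Pair d -` r \<in> sets borel" by auto
  also have "(\<lambda>x. (x, d)) -` r \<union> Pair d -` r = {x. (x, d) \<in> r \<or> (d, x) \<in> r}" by auto
  finally show ?thesis .
qed

text \<open>A point comparable with every element of \<open>C\<close> can be inserted into
  \<open>C\<close> without destroying the chain, so by maximality it already lies in
  \<open>C\<close>.\<close>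

lemma maximal_chain_on_UNIV_eq:
  assumes "refl r" "maximal_chain_on UNIV r C"
  shows "C = {x. \<forall>c\<in>C. (x, c) \<in> r \<or> (c, x) \<in> r}"
proof -
  have r: "(x, x) \<in> r" for x using assms(1) by (rule reflD)
  have chain: "pred_on.chain UNIV (\<lambda>x y. (x, y) \<in> r) C"
    and max: "\<And>S. pred_on.chain UNIV (\<lambda>x y. (x, y) \<in> r) S \<Longrightarrow> \<not> C \<subset> S"
    using assms(2) by (auto simp: maximal_chain_on_def pred_on.maxchain_def)
  have C: "(x, y) \<in> r \<or> (y, x) \<in> r" if "x \<in> C" "y \<in> C" for x y
    using pred_on.chain_total[OF chain that] r by auto
  have "x \<in> C" if "\<forall>c\<in>C. (x, c) \<in> r \<or> (c, x) \<in> r" for x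
  proof -
    have "pred_on.chain UNIV (\<lambda>x y. (x, y) \<in> r) (insert x C)"
      using that C r by (intro pred_on.chainI) auto
    then show ?thesis using max by blast
  qed
  then show ?thesis using C by blast
qed

theorem theorem1:
  fixes r :: "(real \<times> real) set"
  assumes "partial_order_on UNIV r"
    and "r \<in> sets (borel :: (real \<times> real) measure)"
    and "\<And>x y. (x, y) \<in> r \<Longrightarrow> x \<le> y"
    and "finite_width UNIV r"
  shows "\<forall>C. maximal_chain_on UNIV r C \<longrightarrow> C \<in> sets (borel :: real measure)"
proof (intro allI impI)
  fix C assume "maximal_chain_on UNIV r C"
  have r: "refl r" "trans r"
    using assms(1) by (auto simp: partial_order_on_def preorder_on_def)
  note C = maximal_chain_on_UNIV_eq[OF r(1) \<open>maximal_chain_on UNIV r C\<close>]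
  \<comment> \<open>Elements of a chain are comparable, and \<open>(b, a) \<in> r\<close> would
    force \<open>b \<le> a\<close>.\<close>
  have C_le: "(a, b) \<in> r" if "a \<in> C" "b \<in> C" "a < b" for a b
    using that C assms(3)[of b a] by fastforce
  obtain D where D: "countable D" "D \<subseteq> C"
    and left: "\<And>c y. c \<in> C - D \<Longrightarrow> y < c \<Longrightarrow> \<exists>d\<in>D. y < d \<and> d < c"
    and right: "\<And>c y. c \<in> C - D \<Longrightarrow> c < y \<Longrightarrow> \<exists>d\<in>D. c < d \<and> d < y"
    by (rule countable_two_sided_dense_subset[of C]) (erule that)
  have "(x, c) \<in> r \<or> (c, x) \<in> r"
    if x: "\<forall>d\<in>D. (x, d) \<in> r \<or> (d, x) \<in> r" and c: "c \<in> C" for x c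
  proof (rule ccontr)
    assume inc: "\<not> ((x, c) \<in> r \<or> (c, x) \<in> r)"
    then have cD: "c \<in> C - D" using x c by blast
    have below: "d \<le> x" if d: "d \<in> D" "d < c" for d
    proof -
      have "(d, c) \<in> r" using C_le D c d by blast
      \<comment> \<open>Otherwise \<open>x\<close> would be below \<open>c\<close> by transitivity
        through \<open>d\<close>.\<close>
      then have "(x, d) \<notin> r" using inc transD[OF r(2)] by blast
      then show ?thesis using x d assms(3) by blast
    qed
    have above: "x \<le> d" if d: "d \<in> D" "c < d" for d
    proof -
      have "(c, d) \<in> r" using C_le D c d by blast
      then have "(d, x) \<notin> r" using inc transD[OF r(2)] by blast
      then show ?thesis using x d assms(3) by blast
    qed
    \<comment> \<open>If \<open>x < c\<close>, some \<open>d\<close> in \<open>D\<close> would lie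
      strictly between them, against \<open>below\<close>.\<close>
    have "\<not> x < c" using left[OF cD] below by force
    moreover have "\<not> c < x" using right[OF cD] above by force
    ultimately have "x = c" by simp
    then show False using inc reflD[OF r(1)] by blast
  qed
  then have "C = {x. \<forall>d\<in>D. (x, d) \<in> r \<or> (d, x) \<in> r}" using C D(2) by blast
  also have "\<dots> = (\<Inter>d\<in>D. {x. (x, d) \<in> r \<or> (d, x) \<in> r})" by auto
  also have "\<dots> \<in> sets borel"
    \<comment> \<open>An empty \<open>D\<close> is treated apart: the intersection is then the whole
      line.\<close>
    by (cases "D = {}") (auto intro: sets.countable_INT' D borel_comparable[OF assms(2)])
  finally show "C \<in> sets borel" .
qed

end
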